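(* (1) $\mathsf{S}_1(\mathrm{T},\Gamma)=\binom{\mathrm{T}}{\Gamma}\cap\mathsf{S}_{fin}(\Gamma,\mathrm{T})$. (2) $\mathsf{S}_1(\mathcal{B}_\mathrm{T},\mathcal{B}_\Gamma)=\binom{\mathcal{B}_\mathrm{T}}{\mathcal{B}_\Gamma}\cap\mathsf{S}_{fin}(\mathcal{B}_\Gamma,\mathcal{B}_\mathrm{T})$. (Equalities of classes of sets of reals.)
   Context: All spaces $X$ are infinite sets of reals, and all covers considered are assumed not to contain $X$ as a member. A cover is an $\omega$-cover of $X$ if every finite subset of $X$ is contained in some member; a $\gamma$-cover if it is infinite and each point of $X$ lies in all but finitely many members; large if each point lies in infinitely many members. A large cover $\mathcal{U}$ of $X$ is a $\tau$-cover if for all $x,y\in X$, either ($x\in U\Rightarrow y\in U$) for all but finitely many $U\in\mathcal{U}$, or ($y\in U\Rightarrow x\in U$) for all but finitely many $U\in\mathcal{U}$. $\Gamma,\mathrm{T}$ denote the collections of countable open $\gamma$-, $\tau$-covers of $X$, and $\mathcal{B}_\Gamma,\mathcal{B}_\mathrm{T}$ the collections of countable Borel $\gamma$-, $\tau$-covers. For collections $\mathfrak{U},\mathfrak{V}$ of covers: $X$ satisfies $\mathsf{S}_1(\mathfrak{U},\mathfrak{V})$ if for every sequence $(\mathcal{U}_n)$ of members of $\mathfrak{U}$ there are $V_n\in\mathcal{U}_n$ with $\{V_n:n\in\mathbb{N}\}\in\mathfrak{V}$; $X$ satisfies $\mathsf{S}_{fin}(\mathfrak{U},\mathfrak{V})$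 if for every sequence $(\mathcal{U}_n)$ of members of $\mathfrak{U}$ there are finite (possibly empty) $\mathcal{F}_n\subseteq\mathcal{U}_n$ with $\bigcup_n\mathcal{F}_n\in\mathfrak{V}$; $X$ satisfies $\binom{\mathfrak{U}}{\mathfrak{V}}$ if every $\mathcal{U}\in\mathfrak{U}$ has a subcollection $\mathcal{V}\subseteq\mathcal{U}$ with $\mathcal{V}\in\mathfrak{V}$. Properties are identified with the classes of sets satisfying them. *)

theory Defs
  imports "HOL-Analysis.Analysis"
begin

text \<open>Covers of a set of reals \<open>X\<close> consist of subsets of \<open>X\<close>, and \<open>X\<close> itself is never a member.\<close>

definition cover :: "real set \<Rightarrow> real set set \<Rightarrow> bool" where
  "cover X \<U> \<longleftrightarrow> \<U> \<subseteq> Pow X \<and> \<Union>\<U> = X \<and> X \<notin> \<U>"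

definition gamma_cover :: "real set \<Rightarrow> real set set \<Rightarrow> bool" where
  "gamma_cover X \<U> \<longleftrightarrow> cover X \<U> \<and> infinite \<U> \<and> (\<forall>x\<in>X. finite {U \<in> \<U>. x \<notin> U})"

definition large_cover :: "real set \<Rightarrow> real set set \<Rightarrow> bool" where
  "large_cover X \<U> \<longleftrightarrow> cover X \<U> \<and> (\<forall>x\<in>X. infinite {U \<in> \<U>. x \<in> U})"

definition tau_cover :: "real set \<Rightarrow> real set set \<Rightarrow> bool" where
  "tau_cover X \<U> \<longleftrightarrow> large_cover X \<U> \<and>
     (\<forall>x\<in>X. \<forall>y\<in>X. finite {U \<in> \<U>. \<not> (x \<in> U \<longrightarrow> y \<in> U)} \<or>
                    finite {U \<in> \<U>. \<not> (y \<in> U \<longrightarrow> x \<in> U)})"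

text \<open>Open and Borel are understood relative to the subspace \<open>X\<close>. Each collection of covers
  is a function of the space, so that selection principles become classes of spaces.\<close>

definition Open_Gamma :: "real set \<Rightarrow> real set set set" where
  "Open_Gamma X = {\<U>. countable \<U> \<and> (\<forall>U\<in>\<U>. openin (top_of_set X) U) \<and> gamma_cover X \<U>}"

definition Open_Tau :: "real set \<Rightarrow> real set set set" where
  "Open_Tau X = {\<U>. countable \<U> \<and> (\<forall>U\<in>\<U>. openin (top_of_set X) U) \<and> tau_cover X \<U>}"

definition Borel_Gamma :: "real set \<Rightarrow> real set set set" where
  "Borel_Gamma X = {\<U>. countable \<U> \<and> \<U> \<subseteq> sets (restrict_space borel X) \<and> gamma_cover X \<U>}"

definition Borel_Tau :: "real set \<Rightarrow> real set set set" where
  "Borel_Tau X = {\<U>. countable \<U> \<and> \<U> \<subseteq> sets (restrict_space borel X) \<and> tau_cover X \<U>}"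

text \<open>The classes below contain only infinite sets of reals, as all spaces are assumed infinite.\<close>

definition S1 :: "(real set \<Rightarrow> real set set set) \<Rightarrow> (real set \<Rightarrow> real set set set) \<Rightarrow> real set set" where
  "S1 \<AA> \<BB> = {X. infinite X \<and>
     (\<forall>\<U> :: nat \<Rightarrow> real set set. (\<forall>n. \<U> n \<in> \<AA> X) \<longrightarrow>
        (\<exists>V :: nat \<Rightarrow> real set. (\<forall>n. V n \<in> \<U> n) \<and> range V \<in> \<BB> X))}"

definition Sfin :: "(real set \<Rightarrow> real set set set) \<Rightarrow> (real set \<Rightarrow> real set set set) \<Rightarrow> real set set" where
  "Sfin \<AA> \<BB> = {X. infinite X \<and>
     (\<forall>\<U> :: nat \<Rightarrow> real set set. (\<forall>n. \<U> n \<in> \<AA> X) \<longrightarrow>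
        (\<exists>\<F> :: nat \<Rightarrow> real set set. (\<forall>n. finite (\<F> n) \<and> \<F> n \<subseteq> \<U> n) \<and> (\<Union>n. \<F> n) \<in> \<BB> X))}"

definition Sub :: "(real set \<Rightarrow> real set set set) \<Rightarrow> (real set \<Rightarrow> real set set set) \<Rightarrow> real set set" where
  \<comment> \<open>written \<open>(\<AA> choose \<BB>)\<close> in binomial notation in the literature\<close>
  "Sub \<AA> \<BB> = {X. infinite X \<and> (\<forall>\<U> \<in> \<AA> X. \<exists>\<V>. \<V> \<subseteq> \<U> \<and> \<V> \<in> \<BB> X)}"

end

theory Submission
  imports Defs
begin

text \<open>The nontrivial inclusion reduces to \<open>S\<^sub>f\<^sub>i\<^sub>n(\<Gamma>, \<Gamma>) \<subseteq> S\<^sub>1(\<Gamma>, \<Gamma>)\<close>. Enumerate the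
  given \<open>\<gamma>\<close>-covers as \<open>e n 0, e n 1, \<dots>\<close> and replace the \<open>n\<close>-th one by the \<open>\<gamma>\<close>-cover of the sets
  \<open>e 0 m \<inter> \<dots> \<inter> e n m\<close>, which refines all of the first \<open>n + 1\<close>. If the union of finite
  selections \<open>\<F> n\<close> from the new covers is a \<open>\<gamma>\<close>-cover, it is infinite, so for each \<open>n\<close> it has a
  member outside \<open>\<F> 0 \<union> \<dots> \<union> \<F> (n - 1)\<close>; that member lies inside some member of the \<open>n\<close>-th
  original cover.\<close>

text \<open>A finite range would have a value attained infinitely often, which would then be \<open>X\<close>.\<close>

lemma gamma_cover_range:
  fixes W :: "nat \<Rightarrow> real set"
  assumes sub: "\<And>n. W n \<subseteq> X" and ne: "\<And>n. W n \<noteq> X"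
    and fin: "\<And>x. x \<in> X \<Longrightarrow> finite {n. x \<notin> W n}"
  shows "gamma_cover X (range W)"
proof -
  have inf: "infinite (range W)"
  proof
    assume "finite (range W)"
    then obtain w where w: "infinite {n. W n = w}" and "w \<in> range W"
      using inf_img_fin_domE[of W UNIV] by (auto simp: vimage_def)
    have "X \<subseteq> w"
    proof
      fix x assume "x \<in> X"
      then show "x \<in> w"
        using fin w finite_subset[of "{n. W n = w}" "{n. x \<notin> W n}"] by auto
    qed
    with \<open>w \<in> range W\<close> sub ne show False by blast
  qed
  have un: "\<Union>(range W) = X"
  proof (intro equalityI subsetI)
    fix x assume "x \<in> X"
    then have "{n. x \<notin> W n} \<noteq> UNIV"
      using fin by (metis infinite_UNIV_nat)
    then show "x \<in> \<Union>(range W)" by auto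
  qed (use sub in auto)
  have "cover X (range W)"
    unfolding cover_def
  proof (intro conjI)
    show "range W \<subseteq> Pow X" using sub by blast
    show "X \<notin> range W" using ne by (metis imageE)
  qed (rule un)
  moreover have "finite {U \<in> range W. x \<notin> U}" if "x \<in> X" for x
    by (rule finite_subset[OF _ finite_imageI[OF fin[OF that], of W]]) auto
  ultimately show ?thesis
    using inf by (simp add: gamma_cover_def)
qed

text \<open>Only finitely many members omit a given point. Hence infinitely many contain it, and the
  members that contain \<open>x\<close> but omit \<open>y\<close> are among the finitely many
  omitting \<open>y\<close>.\<close>

lemma gamma_cover_imp_tau_cover:
  assumes "gamma_cover X \<U>"
  shows "tau_cover X \<U>"
proof -
  have fin: "finite {U \<in> \<U>. x \<notin> U}" if "x \<in> X" for x
    using assms that by (auto simp: gamma_cover_def)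
  have "infinite {U \<in> \<U>. x \<in> U}" if "x \<in> X" for x
  proof
    assume "finite {U \<in> \<U>. x \<in> U}"
    then have "finite ({U \<in> \<U>. x \<in> U} \<union> {U \<in> \<U>. x \<notin> U})"
      using fin[OF that] by blast
    moreover have "{U \<in> \<U>. x \<in> U} \<union> {U \<in> \<U>. x \<notin> U} = \<U>" by auto
    ultimately show False
      using assms by (simp add: gamma_cover_def)
  qed
  moreover have "finite {U \<in> \<U>. \<not> (x \<in> U \<longrightarrow> y \<in> U)}" if "y \<in> X" for x y
    by (rule finite_subset[OF _ fin[OF that]]) auto
  ultimately show ?thesis
    using assms by (auto simp: tau_cover_def large_cover_def gamma_cover_def)
qed

text \<open>The predicate \<open>P X U\<close> stands for "\<open>U\<close> is open in
  \<open>X\<close>" or "\<open>U\<close> is Borel in \<open>X\<close>", so that one argument proves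
  both equalities.\<close>

definition gamma_covers_by :: "(real set \<Rightarrow> real set \<Rightarrow> bool) \<Rightarrow> real set \<Rightarrow> real set set set" where
  "gamma_covers_by P X = {\<U>. countable \<U> \<and> (\<forall>U\<in>\<U>. P X U) \<and> gamma_cover X \<U>}"

definition tau_covers_by :: "(real set \<Rightarrow> real set \<Rightarrow> bool) \<Rightarrow> real set \<Rightarrow> real set set set" where
  "tau_covers_by P X = {\<U>. countable \<U> \<and> (\<forall>U\<in>\<U>. P X U) \<and> tau_cover X \<U>}"

lemma gamma_covers_by_subset_tau_covers_by: "gamma_covers_by P X \<subseteq> tau_covers_by P X"
  by (auto simp: gamma_covers_by_def tau_covers_by_def intro: gamma_cover_imp_tau_cover)

lemma S1_mono:
  assumes "\<And>X. \<AA>' X \<subseteq> \<AA> X" and "\<And>X. \<BB> X \<subseteq> \<BB>' X"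
  shows "S1 \<AA> \<BB> \<subseteq> S1 \<AA>' \<BB>'"
  unfolding S1_def using assms by (fastforce dest: subsetD)

lemma S1_subset_Sub: "S1 \<AA> \<BB> \<subseteq> Sub \<AA> \<BB>"
proof
  fix X assume X: "X \<in> S1 \<AA> \<BB>"
  have "\<exists>\<V>\<subseteq>\<U>. \<V> \<in> \<BB> X" if "\<U> \<in> \<AA> X" for \<U>
  proof -
    obtain V :: "nat \<Rightarrow> real set" where "\<And>n. V n \<in> \<U>" "range V \<in> \<BB> X"
      using X \<open>\<U> \<in> \<AA> X\<close> by (fastforce simp: S1_def dest!: spec[of _ "\<lambda>_ :: nat. \<U>"])
    then show ?thesis by blast
  qed
  with X show "X \<in> Sub \<AA> \<BB>" by (auto simp: S1_def Sub_def)
qed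

lemma S1_subset_Sfin: "S1 \<AA> \<BB> \<subseteq> Sfin \<AA> \<BB>"
proof
  fix X assume X: "X \<in> S1 \<AA> \<BB>"
  have "\<exists>\<F> :: nat \<Rightarrow> real set set. (\<forall>n. finite (\<F> n) \<and> \<F> n \<subseteq> \<U> n) \<and> (\<Union>n. \<F> n) \<in> \<BB> X"
    if "\<forall>n. \<U> n \<in> \<AA> X" for \<U> :: "nat \<Rightarrow> real set set"
  proof -
    obtain V where "\<forall>n. V n \<in> \<U> n" "range V \<in> \<BB> X"
      using X \<open>\<forall>n. \<U> n \<in> \<AA> X\<close> unfolding S1_def by blast
    moreover have "(\<Union>n. {V n}) = range V" by auto
    ultimately show ?thesis
      by (intro exI[of _ "\<lambda>n. {V n}"]) auto
  qed
  with X show "X \<in> Sfin \<AA> \<BB>" by (auto simp: S1_def Sfin_def)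
qed

lemma SfinE:
  assumes "X \<in> Sfin \<AA> \<BB>" and "\<forall>n. \<U> n \<in> \<AA> X"
  obtains \<F> :: "nat \<Rightarrow> real set set"
  where "\<forall>n. finite (\<F> n) \<and> \<F> n \<subseteq> \<U> n" and "(\<Union>n. \<F> n) \<in> \<BB> X"
  using assms unfolding Sfin_def by blast

text \<open>Each cover is thinned out before the selection; a choice from the subcovers is also a
  choice from the original covers.\<close>

lemma Sub_Int_S1_subset: "Sub \<AA> \<BB> \<inter> S1 \<BB> \<CC> \<subseteq> S1 \<AA> \<CC>"
proof
  fix X assume X: "X \<in> Sub \<AA> \<BB> \<inter> S1 \<BB> \<CC>"
  have "\<exists>V :: nat \<Rightarrow> real set. (\<forall>n. V n \<in> \<U> n) \<and> range V \<in> \<CC> X"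
    if "\<forall>n. \<U> n \<in> \<AA> X" for \<U> :: "nat \<Rightarrow> real set set"
  proof -
    have "\<forall>n. \<exists>\<V>. \<V> \<subseteq> \<U> n \<and> \<V> \<in> \<BB> X"
      using X that by (auto simp: Sub_def)
    then obtain \<V> where \<V>: "\<And>n. \<V> n \<subseteq> \<U> n" "\<And>n. \<V> n \<in> \<BB> X"
      by metis
    have "\<forall>n. \<V> n \<in> \<BB> X" using \<V>(2) by simp
    then obtain V where "\<forall>n. V n \<in> \<V> n" "range V \<in> \<CC> X"
      using X unfolding S1_def by blast
    then show ?thesis using \<V>(1) by blast
  qed
  with X show "X \<in> S1 \<AA> \<CC>" by (auto simp: S1_def)
qed

text \<open>Here the thinning comes after the selection: intersecting every finite family with the
  subcover of their union keeps it finite, possibly empty, and leaves exactly that subcover as the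
  new union.\<close>

lemma Sub_Int_Sfin_subset: "Sub \<BB> \<CC> \<inter> Sfin \<AA> \<BB> \<subseteq> Sfin \<AA> \<CC>"
proof
  fix X assume X: "X \<in> Sub \<BB> \<CC> \<inter> Sfin \<AA> \<BB>"
  have "\<exists>\<F> :: nat \<Rightarrow> real set set. (\<forall>n. finite (\<F> n) \<and> \<F> n \<subseteq> \<U> n) \<and> (\<Union>n. \<F> n) \<in> \<CC> X"
    if "\<forall>n. \<U> n \<in> \<AA> X" for \<U> :: "nat \<Rightarrow> real set set"
  proof -
    obtain \<F> where \<F>: "\<forall>n. finite (\<F> n) \<and> \<F> n \<subseteq> \<U> n" "(\<Union>n. \<F> n) \<in> \<BB> X"
      by (rule SfinE[OF IntD2[OF X] \<open>\<forall>n. \<U> n \<in> \<AA> X\<close>])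
    then obtain \<V> where "\<V> \<subseteq> (\<Union>n. \<F> n)" "\<V> \<in> \<CC> X"
      using X by (auto simp: Sub_def)
    moreover from this have "(\<Union>n. \<F> n \<inter> \<V>) = \<V>" by auto
    ultimately show ?thesis
      using \<F>(1) by (intro exI[of _ "\<lambda>n. \<F> n \<inter> \<V>"]) auto
  qed
  with X show "X \<in> Sfin \<AA> \<CC>" by (auto simp: Sfin_def)
qed

lemma Sfin_gamma_subset_S1_gamma:
  assumes P_Int: "\<And>X U V. P X U \<Longrightarrow> P X V \<Longrightarrow> P X (U \<inter> V)"
  shows "Sfin (gamma_covers_by P) (gamma_covers_by P) \<subseteq> S1 (gamma_covers_by P) (gamma_covers_by P)"
proof
  fix X assume X: "X \<in> Sfin (gamma_covers_by P) (gamma_covers_by P)"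
  have "\<exists>W :: nat \<Rightarrow> real set. (\<forall>n. W n \<in> \<U> n) \<and> range W \<in> gamma_covers_by P X"
    if \<U>: "\<forall>n. \<U> n \<in> gamma_covers_by P X" for \<U> :: "nat \<Rightarrow> real set set"
  proof -
    have cov: "countable (\<U> n)" "gamma_cover X (\<U> n)" and P: "\<And>U. U \<in> \<U> n \<Longrightarrow> P X U" for n
      using \<U> by (auto simp: gamma_covers_by_def)
    have mem: "U \<subseteq> X \<and> U \<noteq> X" if "U \<in> \<U> n" for U n
      using cov(2)[of n] that by (auto simp: gamma_cover_def cover_def)
    \<comment> \<open>Injectivity of this enumeration turns finitely many members omitting
      \<open>x\<close> into finitely many indices.\<close>
    define e where "e n = from_nat_into (\<U> n)" for n
    have "bij_betw (e n) UNIV (\<U> n)" for n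
      using cov[of n] bij_betw_from_nat_into[of "\<U> n"] by (simp add: e_def gamma_cover_def)
    then have e_inj: "inj (e n)" and e_range: "e n m \<in> \<U> n" for n m
      by (auto simp: bij_betw_def)
    have e_fin: "finite {m. x \<notin> e n m}" if "x \<in> X" for x n
    proof -
      have "finite {U \<in> \<U> n. x \<notin> U}"
        using cov(2)[of n] that by (auto simp: gamma_cover_def)
      then have "finite (e n -` {U \<in> \<U> n. x \<notin> U})"
        by (rule finite_vimageI[OF _ e_inj])
      then show ?thesis using e_range by (simp add: vimage_def)
    qed
    define I where "I n m = (\<Inter>i\<le>n. e i m)" for n m
    have P_I: "P X (I n m)" for n m
    proof (induction n)
      case 0
      then show ?case using P[OF e_range] by (simp add: I_def)
    next
      case (Suc n)
      have "I (Suc n) m = e (Suc n) m \<inter> I n m" by (simp add: I_def atMost_Suc)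
      then show ?case using P_Int P e_range Suc by metis
    qed
    have I_e: "I n m \<subseteq> e i m" if "i \<le> n" for i n m
      using that by (auto simp: I_def)
    \<comment> \<open>\<open>I n\<close> may repeat values, so the count runs over indices
      \<open>m\<close>: a point is missed by \<open>I n m\<close> only if one of the
      \<open>n + 1\<close> sets \<open>e i m\<close> misses it.\<close>
    have "gamma_cover X (range (I n))" for n
    proof (rule gamma_cover_range)
      show "I n m \<subseteq> X" "I n m \<noteq> X" for m
        using I_e[of n n m] mem[OF e_range[of n m]] by auto
      fix x assume "x \<in> X"
      then have "finite (\<Union>i\<le>n. {m. x \<notin> e i m})" using e_fin by auto
      moreover have "{m. x \<notin> I n m} = (\<Union>i\<le>n. {m. x \<notin> e i m})" by (auto simp: I_def)
      ultimately show "finite {m. x \<notin> I n m}" by simp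
    qed
    then have "\<forall>n. range (I n) \<in> gamma_covers_by P X"
      using P_I by (auto simp: gamma_covers_by_def)
    with X obtain \<F> where \<F>: "\<forall>n. finite (\<F> n) \<and> \<F> n \<subseteq> range (I n)"
      and "(\<Union>n. \<F> n) \<in> gamma_covers_by P X"
      by (rule SfinE)
    then have \<G>: "gamma_cover X (\<Union>n. \<F> n)" by (simp add: gamma_covers_by_def)
    have fin: "finite (\<F> n)" and sub: "\<F> n \<subseteq> range (I n)" for n
      using \<F> by auto
    have "\<exists>A. A \<in> (\<Union>n. \<F> n) - (\<Union>m<n. \<F> m)" for n
    proof -
      have "finite (\<Union>m<n. \<F> m)" using fin by simp
      then have "infinite ((\<Union>n. \<F> n) - (\<Union>m<n. \<F> m))"
        using \<G> by (intro Diff_infinite_finite) (auto simp: gamma_cover_def)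
      then show ?thesis by (metis all_not_in_conv finite.emptyI)
    qed
    then have "\<exists>A. \<forall>n. A n \<in> (\<Union>n. \<F> n) - (\<Union>m<n. \<F> m)" by (intro choice allI)
    then obtain A where "\<forall>n. A n \<in> (\<Union>n. \<F> n) - (\<Union>m<n. \<F> m)" ..
    then have A: "A n \<in> (\<Union>n. \<F> n) - (\<Union>m<n. \<F> m)" for n ..
    have "\<exists>W\<in>\<U> n. A n \<subseteq> W" for n
    proof -
      \<comment> \<open>Avoiding all families before the \<open>n\<close>-th forces
        \<open>n \<le> k\<close>, so \<open>e n m\<close> is one of the sets intersected in
        \<open>I k m\<close>.\<close>
      obtain k where "A n \<in> \<F> k" "n \<le> k"
        using A[of n] by (auto simp: not_less[symmetric])
      moreover from this obtain m where "A n = I k m" using sub by blast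
      ultimately have "A n \<subseteq> e n m" using I_e by simp
      then show ?thesis using e_range by blast
    qed
    then obtain W where W: "\<And>n. W n \<in> \<U> n" "\<And>n. A n \<subseteq> W n" by metis
    \<comment> \<open>\<open>A\<close> need not be injective, but a member of \<open>\<F> k\<close>
      is excluded from the choice at every \<open>n > k\<close>.\<close>
    have A_fin: "finite {n. A n = a}" if "a \<in> (\<Union>n. \<F> n)" for a
    proof -
      obtain k where "a \<in> \<F> k" using \<open>a \<in> (\<Union>n. \<F> n)\<close> by blast
      then have "{n. A n = a} \<subseteq> {..k}"
        using A by (auto simp: not_less[symmetric])
      then show ?thesis by (rule finite_subset) simp
    qed
    have "gamma_cover X (range W)"
    proof (rule gamma_cover_range)
      show "W n \<subseteq> X" "W n \<noteq> X" for n using mem[OF W(1)] by auto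
      fix x assume "x \<in> X"
      then have "finite {a \<in> \<Union>n. \<F> n. x \<notin> a}"
        using \<G> by (simp add: gamma_cover_def)
      \<comment> \<open>If \<open>W n\<close> misses \<open>x\<close>, so does \<open>A n\<close>.
        Only finitely many sets in the union of the \<open>\<F> n\<close> miss \<open>x\<close>, and
        each is the value of \<open>A\<close> at finitely many indices.\<close>
      then have "finite (\<Union>a\<in>{a \<in> \<Union>n. \<F> n. x \<notin> a}. {n. A n = a})"
        by (rule finite_UN_I) (use A_fin in simp)
      moreover have "{n. x \<notin> W n} \<subseteq> (\<Union>a\<in>{a \<in> \<Union>n. \<F> n. x \<notin> a}. {n. A n = a})"
      proof
        fix n assume "n \<in> {n. x \<notin> W n}"
        then have "x \<notin> A n" using W(2) by blast
        then show "n \<in> (\<Union>a\<in>{a \<in> \<Union>n. \<F> n. x \<notin> a}. {n. A n = a})"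
          using A[of n] by simp
      qed
      ultimately show "finite {n. x \<notin> W n}" by (rule rev_finite_subset)
    qed
    then show ?thesis
      using W(1) P by (auto simp: gamma_covers_by_def)
  qed
  with X show "X \<in> S1 (gamma_covers_by P) (gamma_covers_by P)"
    by (auto simp: S1_def Sfin_def)
qed

text \<open>For the inclusion from right to left, thinning the selected \<tau>-cover gives
  \<open>Sfin ?G ?G\<close>, this improves to \<open>S1 ?G ?G\<close>, and thinning the given
  \<tau>-covers first gives \<open>S1 ?T ?G\<close>. The other inclusion rests on every
  \<gamma>-cover being a \<tau>-cover.\<close>

lemma S1_tau_gamma_eq:
  assumes "\<And>X U V. P X U \<Longrightarrow> P X V \<Longrightarrow> P X (U \<inter> V)"
  shows "S1 (tau_covers_by P) (gamma_covers_by P) =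
    Sub (tau_covers_by P) (gamma_covers_by P) \<inter> Sfin (gamma_covers_by P) (tau_covers_by P)"
  (is "S1 ?T ?G = _")
proof
  have "S1 ?T ?G \<subseteq> S1 ?G ?T"
    by (intro S1_mono gamma_covers_by_subset_tau_covers_by)
  then show "S1 ?T ?G \<subseteq> Sub ?T ?G \<inter> Sfin ?G ?T"
    using S1_subset_Sub S1_subset_Sfin by blast
  show "Sub ?T ?G \<inter> Sfin ?G ?T \<subseteq> S1 ?T ?G"
    using Sub_Int_Sfin_subset[of ?T ?G ?G] Sfin_gamma_subset_S1_gamma[of P, OF assms]
      Sub_Int_S1_subset[of ?T ?G ?G] by blast
qed

theorem theorem2p4:
  shows "S1 Open_Tau Open_Gamma = Sub Open_Tau Open_Gamma \<inter> Sfin Open_Gamma Open_Tau \<and>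
    S1 Borel_Tau Borel_Gamma = Sub Borel_Tau Borel_Gamma \<inter> Sfin Borel_Gamma Borel_Tau"
proof
  have "Open_Tau = tau_covers_by (\<lambda>X. openin (top_of_set X))"
    "Open_Gamma = gamma_covers_by (\<lambda>X. openin (top_of_set X))"
    by (auto simp: fun_eq_iff Open_Tau_def Open_Gamma_def tau_covers_by_def gamma_covers_by_def)
  then show "S1 Open_Tau Open_Gamma = Sub Open_Tau Open_Gamma \<inter> Sfin Open_Gamma Open_Tau"
    using S1_tau_gamma_eq[of "\<lambda>X. openin (top_of_set X)"] by (simp add: openin_Int)
  have "Borel_Tau = tau_covers_by (\<lambda>X U. U \<in> sets (restrict_space borel X))"
    "Borel_Gamma = gamma_covers_by (\<lambda>X U. U \<in> sets (restrict_space borel X))"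
    by (auto simp: fun_eq_iff Borel_Tau_def Borel_Gamma_def tau_covers_by_def gamma_covers_by_def)
  then show "S1 Borel_Tau Borel_Gamma = Sub Borel_Tau Borel_Gamma \<inter> Sfin Borel_Gamma Borel_Tau"
    using S1_tau_gamma_eq[of "\<lambda>X U. U \<in> sets (restrict_space borel X)"]
    by (simp add: sets.Int)
qed

end
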